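(* Let $m$ be a fixed nonnegative integer, $\rho>-1$ real, and let $\alpha>-1$ and $\gamma$ be reals such that $\kappa_m=\alpha-2(\gamma+m)-1$, with $\kappa_m>-1$. Then the fractional Zernike functions $\mathcal{Z}^{\kappa_m,\rho}_{m,n}$, for varying integers $n$ (with $n+\rho\ge 0$), are eigenfunctions on $\mathbb{D}^*$ of the operator $$-(1-|z|^2)^2\frac{\partial^2}{\partial z\,\partial\bar z}-(1-|z|^2)\Big(mE-H^{\rho}_{\kappa_m+m+1}(z)\,\overline{E}\Big)+m\,H^{\rho}_{\kappa_m+m+1}(z)\,|z|^2$$ with $m(\kappa_m+m+1)$ as corresponding eigenvalue.
   Context: Let $\mathbb{D}=\{z\in\mathbb{C}:|z|<1\}$ and $\mathbb{D}^*=\mathbb{D}\setminus\{0\}$; $\partial/\partial z$, $\partial/\partial\bar z$ are the Wirtinger derivatives, $E=z\,\partial/\partial z$ and $\overline{E}=\bar z\,\partial/\partial\bar z$. For real $a,b$ set $H_a^b(z)=a+b-\dfrac{b}{|z|^2}$. For reals $\rho,\kappa>-1$ and integers $m\ge0$, $n$ with $n+\rho\ge0$, the fractional Zernike function on $\mathbb{D}^*$ is $$\mathcal{Z}^{\kappa,\rho}_{m,n}(z,\bar z)=(-1)^m z^{-\rho}(1-|z|^2)^{-\kappa}\frac{\partial^m}{\partial z^m}\Big(z^{n+\rho}(1-|z|^2)^{\kappa+m}\Big),$$ the powers $z^{-\rho}$ and $z^{n+\rho}$ being taken with the same local branch (the result does not depend on the choice). *)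

theory Defs
  imports "HOL-Analysis.Analysis"
begin

abbreviation punctured_disc :: "complex set" where
  "punctured_disc \<equiv> ball 0 1 - {0}"

text \<open>Wirtinger derivatives. The Frechet derivative of a function on \<^typ>\<open>complex\<close> is real-linear,
  so its values at \<^term>\<open>1::complex\<close> and \<^term>\<open>\<i>\<close> are the partial derivatives in \<open>x\<close> and \<open>y\<close>.\<close>

definition wirt :: "(complex \<Rightarrow> complex) \<Rightarrow> complex \<Rightarrow> complex" where
  "wirt f z = (frechet_derivative f (at z) 1 - \<i> * frechet_derivative f (at z) \<i>) / 2"

definition wirtbar :: "(complex \<Rightarrow> complex) \<Rightarrow> complex \<Rightarrow> complex" where
  "wirtbar f z = (frechet_derivative f (at z) 1 + \<i> * frechet_derivative f (at z) \<i>) / 2"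

definition euler :: "(complex \<Rightarrow> complex) \<Rightarrow> complex \<Rightarrow> complex" where
  "euler f z = z * wirt f z"

definition eulerbar :: "(complex \<Rightarrow> complex) \<Rightarrow> complex \<Rightarrow> complex" where
  "eulerbar f z = cnj z * wirtbar f z"

text \<open>Smoothness is meant in the real sense, on open sets; without it
  \<^const>\<open>frechet_derivative\<close> could be an arbitrary value.\<close>

primrec Ck_on :: "nat \<Rightarrow> complex set \<Rightarrow> (complex \<Rightarrow> complex) \<Rightarrow> bool" where
  "Ck_on 0 S f \<longleftrightarrow> continuous_on S f"
| "Ck_on (Suc k) S f \<longleftrightarrow>
     (\<forall>z\<in>S. f differentiable (at z)) \<and> Ck_on k S (wirt f) \<and> Ck_on k S (wirtbar f)"

definition smooth_fun_on :: "complex set \<Rightarrow> (complex \<Rightarrow> complex) \<Rightarrow> bool" where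
  "smooth_fun_on S f \<longleftrightarrow> (\<forall>k. Ck_on k S f)"

definition eigenfunction_on ::
  "complex set \<Rightarrow> ((complex \<Rightarrow> complex) \<Rightarrow> complex \<Rightarrow> complex) \<Rightarrow> complex \<Rightarrow> (complex \<Rightarrow> complex) \<Rightarrow> bool"
  where
  "eigenfunction_on S T \<mu> f \<longleftrightarrow>
     smooth_fun_on S f \<and> (\<exists>z\<in>S. f z \<noteq> 0) \<and> (\<forall>z\<in>S. T f z = \<mu> * f z)"

text \<open>\<open>Hfun a b z\<close> is the function with subscript \<open>a\<close> and superscript \<open>b\<close>.\<close>

definition Hfun :: "real \<Rightarrow> real \<Rightarrow> complex \<Rightarrow> real" where
  "Hfun a b z = a + b - b / (cmod z)\<^sup>2"

definition log_branch_at :: "complex \<Rightarrow> (complex \<Rightarrow> complex) \<Rightarrow> bool" where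
  "log_branch_at z l \<longleftrightarrow>
     (\<exists>U. open U \<and> z \<in> U \<and> l holomorphic_on U \<and> (\<forall>w\<in>U. exp (l w) = w))"

text \<open>\<open>l z\<close> is the local branch of the logarithm used at the point \<open>z\<close>: both powers are
  formed from it, as \<open>w\<^sup>s = exp (s * l z w)\<close>, and the derivatives are taken in \<open>w\<close> with the
  branch kept fixed. The family \<open>l\<close> is arbitrary; no relation between the branches
  at different points is required.\<close>

definition frac_zernike ::
  "(complex \<Rightarrow> complex \<Rightarrow> complex) \<Rightarrow> real \<Rightarrow> real \<Rightarrow> nat \<Rightarrow> int \<Rightarrow> complex \<Rightarrow> complex" where
  "frac_zernike l \<kappa> \<rho> m n z =
     (- 1) ^ m * exp (- of_real \<rho> * l z z) * of_real ((1 - (cmod z)\<^sup>2) powr (- \<kappa>)) *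
     (wirt ^^ m) (\<lambda>w. exp (of_real (of_int n + \<rho>) * l z w) *
                       of_real ((1 - (cmod w)\<^sup>2) powr (\<kappa> + of_nat m))) z"

definition zernike_operator ::
  "nat \<Rightarrow> real \<Rightarrow> real \<Rightarrow> (complex \<Rightarrow> complex) \<Rightarrow> complex \<Rightarrow> complex" where
  "zernike_operator m \<kappa> \<rho> f z =
     - (of_real ((1 - (cmod z)\<^sup>2)\<^sup>2) * wirt (wirtbar f) z)
     - of_real (1 - (cmod z)\<^sup>2) *
         (of_nat m * euler f z - of_real (Hfun (\<kappa> + of_nat m + 1) \<rho> z) * eulerbar f z)
     + of_nat m * of_real (Hfun (\<kappa> + of_nat m + 1) \<rho> z * (cmod z)\<^sup>2) * f z"

end

theory Submission
  imports Defs
begin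

text \<open>
  For fixed \<open>cnj z\<close> the Zernike function is a Rodrigues formula in disguise, so the eigenvalue
  equation is the hypergeometric differential equation of a Jacobi polynomial. Write
  \<open>t = z * cnj z\<close>, \<open>a = n + \<rho>\<close> and \<open>b = \<kappa> + m\<close>.

  Each application of \<open>wirt\<close> to \<open>z\<^sup>a (1 - t)\<^sup>b\<close> lowers both exponents by one and leaves a
  polynomial factor in \<open>t\<close>: the \<open>j\<close>-th derivative is \<open>z\<^bsup>a-j\<^esup> (1 - t)\<^bsup>b-j\<^esup> Q\<^sub>j(t)\<close>, where
  \<open>Q\<^sub>0 = 1\<close> and \<open>Q\<^sub>j\<^sub>+\<^sub>1 = X\<^sub>j Q\<^sub>j + t (1 - t) Q\<^sub>j'\<close> with
  \<open>X\<^sub>j = (a - j) - (a + b - 2 j) t\<close> (\<open>iterated_wirt_rodrigues\<close>). At \<open>j = m\<close> the prefactors of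
  the Zernike function cancel both the branch-dependent power and the power of \<open>1 - t\<close>, and what
  remains is \<open>(-1)\<^sup>m z\<^bsup>n-m\<^esup> Q\<^sub>m(t)\<close> (\<open>frac_zernike_eq\<close>): single-valued, independent of the
  branches, and smooth away from the origin.

  The polynomials satisfy the lowering relation \<open>Q\<^sub>j\<^sub>+\<^sub>1' = -(j+1) (a + b - j) Q\<^sub>j\<close>
  (\<open>pderiv_rodrigues_poly_Suc\<close>). Substituting it into the recursion, which raises the index,
  gives a second-order equation for \<open>Q\<^sub>m\<close> (\<open>rodrigues_poly_ode\<close>). On functions
  \<open>z\<^sup>k P(t)\<close> with \<open>k = n - m\<close> the operator acts as an ordinary differential operator in \<open>t\<close>, and
  after subtraction of the eigenvalue it is \<open>-(1 - t)\<close> times that equation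
  (\<open>zernike_operator_powi_poly\<close>).

  Finally \<open>Q\<^sub>m(1)\<close> is the product of the numbers \<open>j - \<kappa> - m\<close> over \<open>j < m\<close>, none of which vanishes
  for \<open>\<kappa> > -1\<close>; so the function is nonzero close to the unit circle.
\<close>

section \<open>Wirtinger calculus\<close>

text \<open>The two derivatives are introduced together, as the coefficients of the real-linear Frechet
  derivative in the basis \<open>h\<close>, \<open>cnj h\<close>. The product and chain rules for \<^const>\<open>wirt\<close> and
  \<^const>\<open>wirtbar\<close> then follow directly from those for \<^const>\<open>has_derivative\<close>, and
  differentiability is carried along.\<close>

definition has_wirtinger :: "(complex \<Rightarrow> complex) \<Rightarrow> complex \<Rightarrow> complex \<Rightarrow> complex \<Rightarrow> bool" where
  "has_wirtinger f p q z \<longleftrightarrow> (f has_derivative (\<lambda>h. p * h + q * cnj h)) (at z)"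

lemma has_wirtinger_imp:
  assumes "has_wirtinger f p q z"
  shows "wirt f z = p" "wirtbar f z = q" "f differentiable (at z)"
proof -
  have d: "(f has_derivative (\<lambda>h. p * h + q * cnj h)) (at z)"
    using assms by (simp add: has_wirtinger_def)
  then have F: "frechet_derivative f (at z) = (\<lambda>h. p * h + q * cnj h)"
    by (metis frechet_derivative_at)
  show "wirt f z = p" by (simp add: wirt_def F algebra_simps)
  show "wirtbar f z = q" by (simp add: wirtbar_def F algebra_simps)
  show "f differentiable (at z)" using d by (auto simp: differentiable_def)
qed

lemma has_wirtinger_cong_open:
  assumes "has_wirtinger f p q z" "open S" "z \<in> S" "\<And>w. w \<in> S \<Longrightarrow> g w = f w"
  shows "has_wirtinger g p q z"
  using assms has_derivative_transform_within_open[of f _ z UNIV S g]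
  by (auto simp: has_wirtinger_def)

lemma has_wirtinger_holomorphic:
  assumes "(f has_field_derivative d) (at z)"
  shows "has_wirtinger f d 0 z"
  using assms by (simp add: has_wirtinger_def has_field_derivative_def)

lemma has_wirtinger_mult:
  assumes "has_wirtinger f p q z" "has_wirtinger g r s z"
  shows "has_wirtinger (\<lambda>w. f w * g w) (p * g z + f z * r) (q * g z + f z * s) z"
  using has_derivative_mult[OF assms[unfolded has_wirtinger_def]]
  by (simp add: has_wirtinger_def algebra_simps)

lemma has_wirtinger_compose:
  assumes "has_wirtinger f p q z" "(g has_field_derivative d) (at (f z))"
  shows "has_wirtinger (\<lambda>w. g (f w)) (d * p) (d * q) z"
  using has_derivative_compose[OF assms(1)[unfolded has_wirtinger_def]
      assms(2)[unfolded has_field_derivative_def]]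
  by (simp add: has_wirtinger_def algebra_simps)

lemma has_wirtinger_mult_cnj: "has_wirtinger (\<lambda>w. w * cnj w) (cnj z) z z"
proof -
  have "has_wirtinger (\<lambda>w. w) 1 0 z"
    by (intro has_wirtinger_holomorphic DERIV_ident)
  moreover have "has_wirtinger cnj 0 1 z"
    unfolding has_wirtinger_def by (auto intro!: derivative_eq_intros)
  ultimately show ?thesis
    using has_wirtinger_mult by force
qed

section \<open>Integer powers times polynomials in the squared modulus\<close>

text \<open>The functions \<open>z\<^sup>k p(z * cnj z)\<close> with an integer \<open>k\<close> and a polynomial \<open>p\<close> form a class closed
  under both Wirtinger derivatives. This gives smoothness, and it lets second derivatives be
  read off by applying the same rule twice.\<close>

lemma has_wirtinger_powi_poly:
  assumes "z \<noteq> 0"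
  shows "has_wirtinger (\<lambda>w. w powi k * poly p (w * cnj w))
           (z powi (k - 1) * poly (smult (of_int k) p + pCons 0 (pderiv p)) (z * cnj z))
           (z powi (k + 1) * poly (pderiv p) (z * cnj z)) z"
proof -
  have "has_wirtinger (\<lambda>w. w powi k) (of_int k * z powi (k - 1)) 0 z"
    using assms
    by (intro has_wirtinger_holomorphic) (auto intro!: derivative_eq_intros)
  moreover have "has_wirtinger (\<lambda>w. poly p (w * cnj w))
      (poly (pderiv p) (z * cnj z) * cnj z) (poly (pderiv p) (z * cnj z) * z) z"
    by (intro has_wirtinger_compose[OF has_wirtinger_mult_cnj] poly_DERIV)
  moreover have "z powi k = z powi (k - 1) * z" "z powi (k + 1) = z powi k * z"
    using assms by (simp_all add: power_int_diff power_int_add)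
  ultimately show ?thesis
    using has_wirtinger_mult by (force simp: algebra_simps)
qed

lemma has_wirtinger_powi_poly_on:
  assumes "open S" "0 \<notin> S" "z \<in> S" "\<And>w. w \<in> S \<Longrightarrow> f w = w powi k * poly p (w * cnj w)"
  shows "has_wirtinger f
           (z powi (k - 1) * poly (smult (of_int k) p + pCons 0 (pderiv p)) (z * cnj z))
           (z powi (k + 1) * poly (pderiv p) (z * cnj z)) z"
  by (rule has_wirtinger_cong_open[OF has_wirtinger_powi_poly assms(1,3,4)]) (use assms in auto)

text \<open>The induction quantifies over all \<open>f\<close> that agree with a member of the class on \<open>S\<close>,
  since \<^term>\<open>wirt f\<close> has the required form only there.\<close>

lemma Ck_on_powi_poly:
  assumes "open S" "0 \<notin> S" "\<And>w. w \<in> S \<Longrightarrow> f w = w powi k * poly p (w * cnj w)"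
  shows "Ck_on N S f"
  using assms(3)
proof (induction N arbitrary: f k p)
  case 0
  have "continuous_on S (\<lambda>w. w powi k * poly p (w * cnj w))"
    using assms(2) by (auto intro!: continuous_intros)
  with 0 show ?case by (simp cong: continuous_on_cong)
next
  case (Suc N)
  note W = has_wirtinger_imp[OF has_wirtinger_powi_poly_on[OF assms(1,2) _ Suc.prems]]
  show ?case
    using W(3) Suc.IH[OF W(1)] Suc.IH[OF W(2)] by simp
qed

section \<open>Rodrigues polynomials\<close>

text \<open>The polynomial factor of the \<open>j\<close>-th derivative of \<open>t\<^sup>a (1 - t)\<^sup>b\<close>, namely
  \<open>t\<^bsup>j-a\<^esup> (1 - t)\<^bsup>j-b\<^esup>\<close> times that derivative: up to normalisation, the Jacobi polynomial of
  index \<open>j\<close> on \<open>[0, 1]\<close> for the weight \<open>t\<^bsup>a-j\<^esup> (1 - t)\<^bsup>b-j\<^esup>\<close>. The recursion is the product rule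
  for one further derivative; it moves from one weight to the next, so \<open>a\<close> and \<open>b\<close> stay fixed
  while the weight changes with \<open>j\<close>.\<close>

primrec rodrigues_poly :: "'a::field_char_0 \<Rightarrow> 'a \<Rightarrow> nat \<Rightarrow> 'a poly" where
  "rodrigues_poly a b 0 = 1"
| "rodrigues_poly a b (Suc j) =
     [:a - of_nat j, - (a + b - 2 * of_nat j):] * rodrigues_poly a b j
     + [:0, 1, -1:] * pderiv (rodrigues_poly a b j)"

text \<open>With \<open>X\<^sub>j = (a - j) - (a + b - 2 j) t\<close> the coefficient in the recursion, one has
  \<open>X\<^sub>j\<^sub>+\<^sub>1 + (1 - 2 t) = X\<^sub>j\<close>. Differentiate
  \<open>Q\<^sub>j\<^sub>+\<^sub>2 = X\<^sub>j\<^sub>+\<^sub>1 Q\<^sub>j\<^sub>+\<^sub>1 + t (1 - t) Q\<^sub>j\<^sub>+\<^sub>1'\<close> and replace \<open>Q\<^sub>j\<^sub>+\<^sub>1'\<close> by \<open>-c Q\<^sub>j\<close> from the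
  induction hypothesis: the terms with the factor \<open>-c\<close> reassemble to
  \<open>X\<^sub>j Q\<^sub>j + t (1 - t) Q\<^sub>j' = Q\<^sub>j\<^sub>+\<^sub>1\<close>.\<close>

lemma pderiv_rodrigues_poly_Suc:
  "pderiv (rodrigues_poly a b (Suc j)) =
     smult (- (of_nat (Suc j) * (a + b - of_nat j))) (rodrigues_poly a b j)"
proof (induction j)
  case 0
  then show ?case by (simp add: pderiv_pCons)
next
  case (Suc j)
  define Q where "Q = rodrigues_poly a b (Suc j)"
  define R where "R = rodrigues_poly a b j"
  define c where "c = of_nat (Suc j) * (a + b - of_nat j)"
  have dQ: "pderiv Q = smult (- c) R" using Suc by (simp only: Q_def R_def c_def)
  have Q: "Q = [:a - of_nat j, - (a + b - 2 * of_nat j):] * R + [:0, 1, -1:] * pderiv R"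
    by (simp add: Q_def R_def)
  have "poly (pderiv (rodrigues_poly a b (Suc (Suc j)))) t
      = poly (smult (- (of_nat (Suc (Suc j)) * (a + b - of_nat (Suc j)))) Q) t" for t
  proof -
    have q: "poly Q t = (a - of_nat j - (a + b - 2 * of_nat j) * t) * poly R t
        + (t - t * t) * poly (pderiv R) t"
      by (subst Q) (simp add: algebra_simps)
    have "rodrigues_poly a b (Suc (Suc j)) =
        [:a - of_nat (Suc j), - (a + b - 2 * of_nat (Suc j)):] * Q + [:0, 1, -1:] * pderiv Q"
      by (simp only: Q_def rodrigues_poly.simps)
    moreover have "poly (pderiv ([:x, y:] * Q + [:0, 1, -1:] * pderiv Q)) t = y * poly Q t
        + (x + y * t) * poly (pderiv Q) t + (1 - 2 * t) * poly (pderiv Q) t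
        + (t - t * t) * poly (pderiv (pderiv Q)) t" for x y
      by (simp add: pderiv_mult pderiv_add pderiv_pCons algebra_simps
          del: mult_pCons_left mult_pCons_right)
    ultimately have "poly (pderiv (rodrigues_poly a b (Suc (Suc j)))) t =
        - (a + b - 2 * of_nat (Suc j)) * poly Q t
        + (a - of_nat (Suc j) + - (a + b - 2 * of_nat (Suc j)) * t) * (- c * poly R t)
        + (1 - 2 * t) * (- c * poly R t) + (t - t * t) * (- c * poly (pderiv R) t)"
      by (simp only: dQ pderiv_smult poly_smult)
    also have "\<dots> = - (a + b - 2 * of_nat (Suc j)) * poly Q t - c * poly Q t"
      unfolding q by (simp add: algebra_simps)
    finally show ?thesis by (simp add: c_def algebra_simps)
  qed
  then show ?case unfolding Q_def by (intro poly_eq_poly_eq_iff[THEN iffD1] ext)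
qed

text \<open>The lowering relation turns the two derivatives of \<open>Q\<^sub>m\<close> into multiples of \<open>Q\<^sub>m\<^sub>-\<^sub>1\<close> and
  \<open>Q\<^sub>m\<^sub>-\<^sub>1'\<close>, after which the equation is the recursion for \<open>Q\<^sub>m\<close>. It is the hypergeometric
  equation with parameters \<open>-m\<close>, \<open>a + b - m + 1\<close> and \<open>a - m + 1\<close>.\<close>

lemma rodrigues_poly_ode:
  fixes a b t :: "'a::field_char_0" and m :: nat
  defines "Q \<equiv> rodrigues_poly a b m"
  shows "t * (1 - t) * poly (pderiv (pderiv Q)) t
     + (a - of_nat m + 1 - (a + b - 2 * of_nat m + 2) * t) * poly (pderiv Q) t
     + of_nat m * (a + b - of_nat m + 1) * poly Q t = 0"
proof (cases m)
  case 0
  then show ?thesis by (simp add: Q_def)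
next
  case (Suc j)
  define R where "R = rodrigues_poly a b j"
  define c where "c = of_nat m * (a + b - of_nat m + 1)"
  have dQ: "pderiv Q = smult (- c) R"
    using pderiv_rodrigues_poly_Suc[of a b j] by (simp add: Q_def R_def c_def Suc algebra_simps)
  have q: "poly Q t = (a - of_nat j - (a + b - 2 * of_nat j) * t) * poly R t
      + (t - t * t) * poly (pderiv R) t"
    by (simp add: Q_def R_def Suc algebra_simps)
  have "t * (1 - t) * poly (pderiv (pderiv Q)) t
     + (a - of_nat m + 1 - (a + b - 2 * of_nat m + 2) * t) * poly (pderiv Q) t + c * poly Q t = 0"
    unfolding q dQ by (simp add: Suc pderiv_minus pderiv_smult algebra_simps)
  then show ?thesis by (simp add: c_def)
qed

text \<open>At the endpoint \<open>t = 1\<close>, that is on the unit circle, the derivative term of the recursion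
  vanishes. A nonzero value there shows that the eigenfunction is not identically zero.\<close>

lemma poly_rodrigues_poly_1:
  "poly (rodrigues_poly a b m) 1 = (\<Prod>j<m. of_nat j - b)"
  by (induction m) (simp_all add: algebra_simps)

section \<open>Iterated Wirtinger derivatives of the weight\<close>

lemma DERIV_log_branch:
  assumes "open V" "w \<in> V" "L holomorphic_on V" "\<And>u. u \<in> V \<Longrightarrow> exp (L u) = u"
  shows "(L has_field_derivative 1 / w) (at w)"
proof -
  obtain d where d: "(L has_field_derivative d) (at w)"
    using assms(1-3) by (metis holomorphic_on_imp_differentiable_at field_differentiable_def)
  have "((\<lambda>u. exp (L u)) has_field_derivative exp (L w) * d) (at w)"
    using d by (auto intro!: derivative_eq_intros)
  then have "((\<lambda>u. u) has_field_derivative exp (L w) * d) (at w)"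
    by (rule has_field_derivative_transform_within_open) (use assms in auto)
  then have "exp (L w) * d = 1"
    using DERIV_unique DERIV_ident by blast
  then show ?thesis
    using d assms(2,4) by (metis exp_not_eq_zero nonzero_mult_div_cancel_left)
qed

lemma one_minus_norm_sq: "1 - w * cnj w = of_real (1 - (cmod w)\<^sup>2)"
  by (metis complex_norm_square of_real_1 of_real_diff)

text \<open>In the variable \<open>z\<close> alone, \<open>wirt\<close> differentiates \<open>1 - z * cnj z\<close> to \<open>- cnj z\<close>. Taking out one
  factor \<open>1 / z\<close> and one factor \<open>(1 - t)\<^bsup>-1\<^esup>\<close> at each step, the product rule yields exactly the
  recursion of \<^const>\<open>rodrigues_poly\<close>. The complex power is harmless because \<open>1 - t\<close> is a positive
  real on the disc.\<close>

lemma iterated_wirt_rodrigues: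
  fixes a b :: complex
  assumes "open V" "V \<subseteq> punctured_disc" "L holomorphic_on V" "\<And>u. u \<in> V \<Longrightarrow> exp (L u) = u"
    and "\<And>u. u \<in> V \<Longrightarrow> f u = exp (a * L u) * (1 - u * cnj u) powr b"
    and "w \<in> V"
  shows "(wirt ^^ j) f w =
      exp (a * L w) * (1 - w * cnj w) powr (b - of_nat j) *
      (w powi (- int j) * poly (rodrigues_poly a b j) (w * cnj w))"
  using \<open>w \<in> V\<close>
proof (induction j arbitrary: w)
  case 0
  then show ?case by (simp add: assms(5))
next
  case (Suc j)
  define Q where "Q = rodrigues_poly a b j"
  define t where "t = w * cnj w"
  define P where "P = (1 - t) powr (b - of_nat (Suc j))"
  define I where "I = w powi (- int (Suc j))"
  define X where "X = exp (a * L w)"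
  define d where "d = a / w"
  have w0: "w \<noteq> 0" and w1: "cmod w < 1" using Suc.prems assms(2) by auto
  have pos: "1 - (cmod w)\<^sup>2 > 0"
    using w1 by (simp add: power_less_one_iff abs_square_less_1)
  have npos: "1 - t \<notin> \<real>\<^sub>\<le>\<^sub>0"
    unfolding t_def one_minus_norm_sq using pos by (simp add: complex_nonpos_Reals_iff)
  then have t1: "1 - t \<noteq> 0" by auto
  have wE: "has_wirtinger (\<lambda>u. exp (a * L u)) (X * (a / w)) 0 w"
    using DERIV_log_branch[OF assms(1) Suc.prems assms(3,4)] unfolding X_def
    by (intro has_wirtinger_holomorphic) (auto intro!: derivative_eq_intros)
  have "((\<lambda>x. (1 - x) powr (b - of_nat j)) has_field_derivative - ((b - of_nat j) * P)) (at t)"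
    using npos unfolding P_def by (auto intro!: derivative_eq_intros simp: algebra_simps)
  then have wP: "has_wirtinger (\<lambda>u. (1 - u * cnj u) powr (b - of_nat j))
      (- ((b - of_nat j) * P) * cnj w) (- ((b - of_nat j) * P) * w) w"
    unfolding t_def by (rule has_wirtinger_compose[OF has_wirtinger_mult_cnj])
  note wQ = has_wirtinger_powi_poly[OF w0, of "- int j" Q]
  have split: "w powi (- int j - 1) = I" "w powi (- int j) = I * w"
    "(1 - t) powr (b - of_nat j) = P * (1 - t)"
  proof -
    have "- int j - 1 = - int (Suc j)" by simp
    then show "w powi (- int j - 1) = I" by (simp only: I_def)
    show "w powi (- int j) = I * w"
      using w0 power_int_add[of w "- int (Suc j)" 1] by (simp add: I_def)
    show "(1 - t) powr (b - of_nat j) = P * (1 - t)"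
      using t1 powr_add[of "1 - t" "b - of_nat (Suc j)" 1] by (simp add: P_def algebra_simps)
  qed
  have "(wirt ^^ Suc j) f w =
      ((X * (a / w)) * (1 - t) powr (b - of_nat j) + X * (- ((b - of_nat j) * P) * cnj w))
        * (w powi (- int j) * poly Q t)
      + X * (1 - t) powr (b - of_nat j) *
        (w powi (- int j - 1) * poly (smult (of_int (- int j)) Q + pCons 0 (pderiv Q)) t)"
    using has_wirtinger_imp(1)[OF has_wirtinger_cong_open[OF
        has_wirtinger_mult[OF has_wirtinger_mult[OF wE wP] wQ] assms(1) Suc.prems]] Suc.IH
    by (simp add: t_def X_def Q_def)
  also have "\<dots> = X * P * I * (((a / w * w) * (1 - t) - (b - of_nat j) * (w * cnj w)) * poly Q t
      + (1 - t) * (- of_nat j * poly Q t + t * poly (pderiv Q) t))"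
    unfolding split d_def[symmetric] by (simp add: algebra_simps)
  also have "\<dots> = X * P * (I * poly (rodrigues_poly a b (Suc j)) t)"
  proof -
    have "a / w * w = a" using w0 by simp
    moreover have "poly (rodrigues_poly a b (Suc j)) t =
        (a * (1 - t) - (b - of_nat j) * t) * poly Q t
        + (1 - t) * (- of_nat j * poly Q t + t * poly (pderiv Q) t)"
      by (simp add: Q_def algebra_simps)
    ultimately show ?thesis by (simp only: t_def[symmetric] mult.assoc)
  qed
  finally show ?case by (simp only: X_def P_def I_def t_def)
qed

section \<open>The eigenvalue equation\<close>

text \<open>For \<open>f = z\<^sup>k P(t)\<close> all terms of the operator carry the factor \<open>z\<^sup>k\<close>, and the singular
  function \<^const>\<open>Hfun\<close> enters only multiplied by \<open>t\<close>, where it is affine in \<open>t\<close>. Subtracting the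
  eigenvalue leaves \<open>-(1 - t) z\<^sup>k\<close> times the hypergeometric expression in \<open>P\<close>; the coefficient of
  \<open>P\<close> itself acquires its factor \<open>1 - t\<close> because the eigenvalue \<open>m (\<kappa> + m + 1)\<close> is the value of
  \<open>m t\<close> \<^const>\<open>Hfun\<close> at \<open>t = 1\<close>.\<close>

lemma zernike_operator_powi_poly:
  fixes f :: "complex \<Rightarrow> complex" and P :: "complex poly" and m :: nat and \<kappa> \<rho> :: real
  assumes "open S" "0 \<notin> S" "z \<in> S" "\<And>w. w \<in> S \<Longrightarrow> f w = w powi k * poly P (w * cnj w)"
    and ode: "t * (1 - t) * poly (pderiv (pderiv P)) t
      + (a - of_nat m + 1 - (a + of_real \<kappa> - of_nat m + 2) * t) * poly (pderiv P) t
      + of_nat m * (a + of_real \<kappa> + 1) * poly P t = 0"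
    and a: "a = of_int k + of_nat m + of_real \<rho>" and t: "t = z * cnj z"
  shows "zernike_operator m \<kappa> \<rho> f z = of_real (real m * (\<kappa> + real m + 1)) * f z"
proof -
  define A where "A = z powi k"
  define P0 where "P0 = poly P t"
  define P1 where "P1 = poly (pderiv P) t"
  define P2 where "P2 = poly (pderiv (pderiv P)) t"
  define K where "K = (of_int k :: complex)"
  define M where "M = (of_nat m :: complex)"
  define R where "R = complex_of_real (Hfun (\<kappa> + of_nat m + 1) \<rho> z)"
  define c where "c = complex_of_real \<kappa>"
  define r where "r = complex_of_real \<rho>"
  have z0: "z \<noteq> 0" using assms(2,3) by auto
  have pw: "z powi (k - 1) * z = A" "z powi (k + 1) = A * z" "z powi (k + 1 - 1) = A"
    using z0 by (simp_all add: A_def power_int_diff power_int_add)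
  note W = has_wirtinger_imp[OF has_wirtinger_powi_poly_on[OF assms(1,2) _ assms(4)]]
  note W2 = has_wirtinger_imp[OF has_wirtinger_powi_poly_on[OF assms(1,2) _ W(2)]]
  have f: "f z = A * P0" by (simp add: assms(3,4) A_def P0_def t)
  have e: "euler f z = A * (K * P0 + t * P1)"
    unfolding euler_def pw(1)[symmetric]
    using W(1)[OF assms(3)]
    by (simp add: P0_def P1_def K_def t algebra_simps)
  have eb: "eulerbar f z = A * t * P1"
    using W(2)[OF assms(3)] pw(2) by (simp add: eulerbar_def P1_def t)
  have l: "wirt (wirtbar f) z = A * ((K + 1) * P1 + t * P2)"
    using W2(1)[OF assms(3)] pw(3) by (simp add: P1_def P2_def K_def t algebra_simps)
  have tn: "complex_of_real ((cmod z)\<^sup>2) = t" by (simp only: t complex_norm_square)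
  have Rt: "R * t = (c + M + 1 + r) * t - r"
  proof -
    have "Hfun (\<kappa> + of_nat m + 1) \<rho> z * (cmod z)\<^sup>2 = (\<kappa> + real m + 1 + \<rho>) * (cmod z)\<^sup>2 - \<rho>"
      using z0 by (simp add: Hfun_def field_simps)
    then have "complex_of_real (Hfun (\<kappa> + of_nat m + 1) \<rho> z * (cmod z)\<^sup>2)
        = complex_of_real ((\<kappa> + real m + 1 + \<rho>) * (cmod z)\<^sup>2 - \<rho>)" by simp
    then show ?thesis by (simp add: R_def c_def M_def r_def tn flip: of_real_power)
  qed
  have "zernike_operator m \<kappa> \<rho> f z =
      - ((1 - t)\<^sup>2 * (A * ((K + 1) * P1 + t * P2)))
      - (1 - t) * (M * (A * (K * P0 + t * P1)) - A * P1 * (R * t)) + M * (R * t) * (A * P0)"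
    unfolding zernike_operator_def e eb l f of_real_power of_real_mult of_real_diff of_real_1
      tn[unfolded of_real_power] R_def[symmetric] M_def[symmetric]
    by (simp only: mult_ac)
  also have "\<dots> - M * (c + M + 1) * (A * P0) =
      - (1 - t) * A * (t * (1 - t) * P2 + (a - M + 1 - (a + c - M + 2) * t) * P1
        + M * (a + c + 1) * P0)"
    unfolding Rt a K_def[symmetric] M_def[symmetric] r_def[symmetric]
    by (simp add: algebra_simps power2_eq_square)
  also have "\<dots> = 0"
    using ode by (simp add: P0_def P1_def P2_def M_def c_def)
  finally show ?thesis by (simp add: f c_def M_def)
qed

text \<open>The two branch-dependent exponentials combine to \<open>exp (n * l z z)\<close>, an integer power of \<open>z\<close>;
  here the arbitrary choice of the branches disappears.\<close>

lemma frac_zernike_eq: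
  assumes "log_branch_at z (l z)" "z \<in> punctured_disc"
  shows "frac_zernike l \<kappa> \<rho> m n z = z powi (n - int m) *
    poly (smult ((- 1) ^ m) (rodrigues_poly (of_real (of_int n + \<rho>)) (of_real (\<kappa> + real m)) m))
      (z * cnj z)"
proof -
  obtain U where U: "open U" "z \<in> U" "l z holomorphic_on U" "\<And>w. w \<in> U \<Longrightarrow> exp (l z w) = w"
    using assms(1) by (auto simp: log_branch_at_def)
  \<comment> \<open>The branch may be defined beyond the disc, where the base of the power is not positive.\<close>
  define V where "V = U \<inter> punctured_disc"
  define y where "y = 1 - (cmod z)\<^sup>2"
  define Q where "Q = rodrigues_poly (complex_of_real (of_int n + \<rho>)) (of_real (\<kappa> + real m)) m"
  have V: "open V" "V \<subseteq> punctured_disc" "l z holomorphic_on V" "\<And>w. w \<in> V \<Longrightarrow> exp (l z w) = w"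
      "z \<in> V"
    using U assms(2) by (auto simp: V_def intro: holomorphic_on_subset open_Int open_delete)
  have y: "y > 0" using assms(2) by (simp add: y_def power_less_one_iff abs_square_less_1)
  have z0: "z \<noteq> 0" using assms(2) by auto
  have rp: "of_real ((1 - (cmod w)\<^sup>2) powr s) = (1 - w * cnj w) powr of_real s"
    if "w \<in> V" for w s
  proof -
    have "(cmod w)\<^sup>2 \<le> 1" using that V(2) by (auto simp: abs_square_le_1)
    then show ?thesis by (simp only: one_minus_norm_sq powr_of_real diff_ge_0_iff_ge)
  qed
  have D: "(wirt ^^ m) (\<lambda>w. exp (of_real (of_int n + \<rho>) * l z w) *
      of_real ((1 - (cmod w)\<^sup>2) powr (\<kappa> + of_nat m))) z =
      exp (of_real (of_int n + \<rho>) * l z z) * of_real (y powr \<kappa>) * (z powi (- int m) * poly Q (z * cnj z))"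
    using iterated_wirt_rodrigues[OF V(1-4) _ V(5), where b = "of_real (\<kappa> + of_nat m)" and j = m]
      rp[OF V(5), of \<kappa>] rp
    by (simp add: Q_def y_def)
  have "exp (- of_real \<rho> * l z z) * exp (of_real (of_int n + \<rho>) * l z z) = exp (of_int n * l z z)"
    by (simp add: algebra_simps flip: exp_add)
  also have "\<dots> = z powi n"
    using V(4,5) by (simp flip: exp_power_int)
  finally have E: "exp (- of_real \<rho> * l z z) * exp (of_real (of_int n + \<rho>) * l z z) = z powi n" .
  have Y: "complex_of_real (y powr (- \<kappa>)) * of_real (y powr \<kappa>) = 1"
    using y by (simp flip: of_real_mult powr_add)
  have N: "z powi (n - int m) = z powi n * z powi (- int m)"
    using z0 power_int_add[of z n "- int m"] by simp
  have "frac_zernike l \<kappa> \<rho> m n z = (- 1) ^ m *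
      (exp (- of_real \<rho> * l z z) * exp (of_real (of_int n + \<rho>) * l z z)) *
      (complex_of_real (y powr (- \<kappa>)) * of_real (y powr \<kappa>)) * (z powi (- int m) * poly Q (z * cnj z))"
    unfolding frac_zernike_def D y_def by (simp only: mult_ac)
  then show ?thesis
    unfolding E Y N by (simp add: Q_def)
qed

text \<open>The value at \<open>1\<close> is the boundary value on the unit circle, so by continuity the witness can
  be taken on the positive real radius close to the circle.\<close>

lemma exists_powi_poly_nonzero:
  fixes P :: "complex poly"
  assumes "poly P 1 \<noteq> 0"
  shows "\<exists>z\<in>punctured_disc. z powi k * poly P (z * cnj z) \<noteq> 0"
proof -
  have "((\<lambda>x::real. poly P (of_real x * cnj (of_real x))) \<longlongrightarrow> poly P (of_real 1 * cnj (of_real 1))) (at_left 1)"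
    by (intro tendsto_intros)
  then have "\<forall>\<^sub>F x::real in at_left 1. poly P (of_real x * cnj (of_real x)) \<noteq> 0"
    using assms by (intro tendsto_imp_eventually_ne) auto
  moreover have "\<forall>\<^sub>F x::real in at_left 1. x \<in> {0<..<1}"
    by (rule eventually_at_left_real) simp
  ultimately have "\<forall>\<^sub>F x::real in at_left 1. poly P (of_real x * cnj (of_real x)) \<noteq> 0 \<and> x \<in> {0<..<1}"
    by (rule eventually_conj)
  then obtain x :: real where "poly P (of_real x * cnj (of_real x)) \<noteq> 0" "x \<in> {0<..<1}"
    using eventually_happens'[OF trivial_limit_at_left_real] by blast
  then show ?thesis
    by (intro bexI[of _ "of_real x"]) auto
qed

theorem theorem3p14:
  fixes m :: nat and n :: int and \<rho> \<alpha> \<gamma> \<kappa> :: real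
    and l :: "complex \<Rightarrow> complex \<Rightarrow> complex"
  assumes "\<rho> > -1" and "\<alpha> > -1"
    and "\<kappa> = \<alpha> - 2 * (\<gamma> + real m) - 1" and "\<kappa> > -1"
    and "of_int n + \<rho> \<ge> 0"
    and "\<And>z. z \<in> punctured_disc \<Longrightarrow> log_branch_at z (l z)"
  shows "eigenfunction_on punctured_disc (zernike_operator m \<kappa> \<rho>)
           (of_real (real m * (\<kappa> + real m + 1))) (frac_zernike l \<kappa> \<rho> m n)"
proof -
  define a where "a = complex_of_real (of_int n + \<rho>)"
  define b where "b = complex_of_real (\<kappa> + real m)"
  define P where "P = smult ((- 1) ^ m) (rodrigues_poly a b m)"
  have S: "open punctured_disc" "0 \<notin> punctured_disc" by (auto intro: open_delete)
  have Z: "frac_zernike l \<kappa> \<rho> m n z = z powi (n - int m) * poly P (z * cnj z)"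
    if "z \<in> punctured_disc" for z
    using frac_zernike_eq[of z l] assms(6) that by (simp only: P_def a_def b_def)
  have "of_nat j - b \<noteq> 0" if "j < m" for j
  proof -
    have "real j - (\<kappa> + real m) < 0" using that \<open>\<kappa> > -1\<close> by linarith
    then have "complex_of_real (real j - (\<kappa> + real m)) \<noteq> 0" by (simp only: of_real_eq_0_iff)
    then show ?thesis by (simp add: b_def)
  qed
  then have "poly P 1 \<noteq> 0" by (simp add: P_def poly_rodrigues_poly_1)
  then have "\<exists>z\<in>punctured_disc. frac_zernike l \<kappa> \<rho> m n z \<noteq> 0"
    using exists_powi_poly_nonzero[of P "n - int m"] Z by auto
  moreover have "smooth_fun_on punctured_disc (frac_zernike l \<kappa> \<rho> m n)"
    unfolding smooth_fun_on_def using Ck_on_powi_poly[OF S Z] by blast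
  moreover have "zernike_operator m \<kappa> \<rho> (frac_zernike l \<kappa> \<rho> m n) z =
      of_real (real m * (\<kappa> + real m + 1)) * frac_zernike l \<kappa> \<rho> m n z"
    if z: "z \<in> punctured_disc" for z
  proof (rule zernike_operator_powi_poly[OF S z Z _ _ refl])
    define Q where "Q = rodrigues_poly a b m"
    define s :: complex where "s = (- 1) ^ m"
    define t where "t = z * cnj z"
    have b: "b = of_real \<kappa> + of_nat m" by (simp add: b_def)
    have P: "poly P t = s * poly Q t" "poly (pderiv P) t = s * poly (pderiv Q) t"
      "poly (pderiv (pderiv P)) t = s * poly (pderiv (pderiv Q)) t"
      by (simp_all add: P_def Q_def s_def pderiv_smult)
    have "t * (1 - t) * poly (pderiv (pderiv P)) t
      + (a - of_nat m + 1 - (a + of_real \<kappa> - of_nat m + 2) * t) * poly (pderiv P) t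
      + of_nat m * (a + of_real \<kappa> + 1) * poly P t
      = s * (t * (1 - t) * poly (pderiv (pderiv Q)) t
      + (a - of_nat m + 1 - (a + b - 2 * of_nat m + 2) * t) * poly (pderiv Q) t
      + of_nat m * (a + b - of_nat m + 1) * poly Q t)"
      unfolding P b by (simp add: algebra_simps)
    also have "\<dots> = 0" unfolding Q_def rodrigues_poly_ode by simp
    finally show "z * cnj z * (1 - z * cnj z) * poly (pderiv (pderiv P)) (z * cnj z)
      + (a - of_nat m + 1 - (a + of_real \<kappa> - of_nat m + 2) * (z * cnj z)) * poly (pderiv P) (z * cnj z)
      + of_nat m * (a + of_real \<kappa> + 1) * poly P (z * cnj z) = 0"
      by (simp only: t_def)
    show "a = of_int (n - int m) + of_nat m + of_real \<rho>" by (simp add: a_def)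
  qed
  ultimately show ?thesis by (simp add: eigenfunction_on_def)
qed

end
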